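(* Let $p$ be an odd prime, $k\in\mathbb{N}$, $\lambda\in\mathbb{Z}_p$ with $\lambda\ne0$, and $x\in\mathbb{C}_p$. For every integer $m\ge0$, \[ \sum_{n=0}^{m}Bl_n^{(k)}(x|\lambda)\,S_2(m,n)=\frac{\lambda^m}{2^k}E_m^{(k)}\!\left(\frac{x}{\lambda}\right). \]
   Context: For a continuous $f:\mathbb{Z}_p\to\mathbb{C}_p$, the fermionic $p$-adic integral is $\int_{\mathbb{Z}_p}f(y)\,d\mu_{-1}(y)=\lim_{N\to\infty}\sum_{a=0}^{p^N-1}f(a)(-1)^a$. $(z)_n=z(z-1)\cdots(z-n+1)$ is the falling factorial. The Boole polynomials of order $k$ are defined by \[ 2^kBl_n^{(k)}(x|\lambda)=\int_{\mathbb{Z}_p}\cdots\int_{\mathbb{Z}_p}(\lambda x_1+\cdots+\lambda x_k+x)_n\,d\mu_{-1}(x_1)\cdots d\mu_{-1}(x_k). \] The Euler polynomials of order $k$ are defined by $\left(\frac{2}{e^t+1}\right)^k e^{xt}=\sum_{n\ge0}E_n^{(k)}(x)\frac{t^n}{n!}$. The Stirling numbers of the second kind are defined by $(e^t-1)^n=n!\sum_{l\ge n}S_2(l,n)\frac{t^l}{l!}$. *)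

theory Defs
  imports
    "HOL-Analysis.Analysis"
    "HOL-Computational_Algebra.Computational_Algebra"
    "HOL-Combinatorics.Stirling"
begin

section \<open>The field of complex \<open>p\<close>-adic numbers\<close>

definition algebraic_over :: "'c::field set \<Rightarrow> 'c set" where
  "algebraic_over K = {\<alpha>. \<exists>q. q \<noteq> 0 \<and> (\<forall>i. coeff q i \<in> K) \<and> poly q \<alpha> = 0}"

text \<open>
  The absolute value is the distance to \<open>0\<close>. (The library classes of normed fields cannot be
  used: they are real algebras and force an archimedean norm on the rationals.)
\<close>
definition vabs :: "'c::{zero, metric_space} \<Rightarrow> real" where
  "vabs x = dist x 0"

text \<open>
  In a complete field extending the rationals with their \<open>p\<close>-adic absolute value, the completion
  of the rationals is their closure, and the \<open>p\<close>-adic integers are its unit ball.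
\<close>
definition padic_numbers :: "'c::{field_char_0, metric_space} set" where
  "padic_numbers = closure \<rat>"

definition padic_integers :: "'c::{field_char_0, metric_space} set" where
  "padic_integers = {x \<in> padic_numbers. vabs x \<le> 1}"

text \<open>
  \<open>padic_complex p TYPE('c)\<close> says that \<open>'c\<close>, with its metric, is the completion of an algebraic
  closure of the field of \<open>p\<close>-adic numbers. For prime \<open>p\<close> this determines \<open>'c\<close> up to isometric
  field isomorphism. Completeness of \<open>'c\<close> is the class \<^class>\<open>complete_space\<close>; the
  last two conjuncts say that the algebraic closure of the \<open>p\<close>-adic numbers in \<open>'c\<close> is
  algebraically closed and dense.
\<close>
definition padic_complex :: "nat \<Rightarrow> 'c::{field_char_0, complete_space} itself \<Rightarrow> bool" where
  "padic_complex p (C :: 'c itself) \<longleftrightarrow>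
     (\<forall>x y :: 'c. dist x y = vabs (x - y)) \<and>
     (\<forall>x y :: 'c. vabs (x * y) = vabs x * vabs y) \<and>
     (\<forall>x y :: 'c. vabs (x + y) \<le> max (vabs x) (vabs y)) \<and>
     (\<forall>n :: int. n \<noteq> 0 \<longrightarrow>
        vabs (of_int n :: 'c) = 1 / real p ^ multiplicity (int p) n) \<and>
     (\<forall>q :: 'c poly. degree q > 0 \<longrightarrow>
        (\<forall>i. coeff q i \<in> algebraic_over padic_numbers) \<longrightarrow>
        (\<exists>\<alpha> \<in> algebraic_over padic_numbers. poly q \<alpha> = 0)) \<and>
     closure (algebraic_over padic_numbers) = (UNIV :: 'c set)"


section \<open>Fermionic integrals and Boole polynomials\<close>

definition fermionic_integral ::
    "nat \<Rightarrow> ('c::{field_char_0, metric_space} \<Rightarrow> 'c) \<Rightarrow> 'c" where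
  "fermionic_integral p f = lim (\<lambda>N. \<Sum>a<p ^ N. f (of_nat a) * (- 1) ^ a)"

text \<open>
  The \<open>k\<close>-fold iterated integral of \<open>F [x\<^sub>1, \<dots>, x\<^sub>k]\<close>; the innermost integration is over \<open>x\<^sub>1\<close>,
  the outermost over \<open>x\<^sub>k\<close>.
\<close>
primrec iterated_fermionic_integral ::
    "nat \<Rightarrow> nat \<Rightarrow> ('c::{field_char_0, metric_space} list \<Rightarrow> 'c) \<Rightarrow> 'c" where
  "iterated_fermionic_integral p 0 F = F []"
| "iterated_fermionic_integral p (Suc k) F =
     fermionic_integral p (\<lambda>y. iterated_fermionic_integral p k (\<lambda>ys. F (ys @ [y])))"

definition falling_factorial :: "'c::comm_ring_1 \<Rightarrow> nat \<Rightarrow> 'c" where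
  "falling_factorial z n = (\<Prod>i<n. z - of_nat i)"

definition Boole_poly ::
    "nat \<Rightarrow> nat \<Rightarrow> nat \<Rightarrow> 'c::{field_char_0, metric_space} \<Rightarrow> 'c \<Rightarrow> 'c" where
  "Boole_poly p k n x l =
     iterated_fermionic_integral p k
       (\<lambda>ys. falling_factorial ((\<Sum>y\<leftarrow>ys. l * y) + x) n) / 2 ^ k"


section \<open>Euler polynomials and Stirling numbers\<close>

definition Euler_poly :: "nat \<Rightarrow> nat \<Rightarrow> 'c::field_char_0 \<Rightarrow> 'c" where
  "Euler_poly k n x = fact n * fps_nth ((2 / (fps_exp 1 + 1)) ^ k * fps_exp x) n"

text \<open>
  The Stirling numbers of the second kind are the library's \<^const>\<open>Stirling\<close>, which is defined by
  recursion. They have the usual generating function: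
\<close>
lemma Stirling_generating_function:
  "(fps_exp 1 - 1 :: 'c::field_char_0 fps) ^ n =
     fps_const (fact n) * Abs_fps (\<lambda>l. of_nat (Stirling l n) / fact l)"
proof -
  let ?G = "fps_exp 1 - 1 :: 'c fps"
  have "fps_nth (?G ^ n) l = fact n * of_nat (Stirling l n) / fact l" for l
  proof (induction l arbitrary: n)
    case 0
    show ?case by (cases n) (simp_all add: fps_nth_power_0)
  next
    case (Suc l)
    show ?case
    proof (cases n)
      case 0
      then show ?thesis by simp
    next
      case n: (Suc k)
      have "fps_deriv (?G ^ Suc k) = of_nat (Suc k) * (?G ^ Suc k + ?G ^ k)"
        unfolding fps_deriv_power' by (simp add: algebra_simps del: of_nat_Suc)
      then have "fps_nth (fps_deriv (?G ^ Suc k)) l =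
          of_nat (Suc k) * (fps_nth (?G ^ Suc k) l + fps_nth (?G ^ k) l)"
        by (simp only: fps_of_nat[symmetric] fps_mult_left_const_nth fps_add_nth)
      then have "of_nat (Suc l) * fps_nth (?G ^ Suc k) (Suc l) =
          of_nat (Suc k) * (fact (Suc k) * of_nat (Stirling l (Suc k)) / fact l
            + fact k * of_nat (Stirling l k) / fact l)"
        by (simp only: fps_deriv_nth Suc.IH Suc_eq_plus1)
      also have "\<dots> = fact (Suc k) * of_nat (Stirling (Suc l) (Suc k)) / fact l"
        by (simp add: field_simps)
      finally show ?thesis
        unfolding n by (simp add: field_simps del: of_nat_Suc Stirling.simps power_Suc)
    qed
  qed
  then show ?thesis by (simp add: fps_eq_iff)
qed

end

theory Submission
  imports Defs
begin

text \<open>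
  If \<open>g y + g (y + 1) = 2 * f y\<close>, the alternating sum of \<open>f\<close> over \<open>a < p ^ N\<close> telescopes to
  \<open>(g 0 + g (p ^ N)) / 2\<close> because \<open>p ^ N\<close> is odd; as \<open>p ^ N\<close> tends to \<open>0\<close> \<open>p\<close>-adically, a
  polynomial \<open>g\<close> gives the integral \<open>g 0\<close>. For \<open>f y = E\<^sub>i\<^sup>(\<^sup>k\<^sup>)(y + z)\<close> one may take
  \<open>g y = E\<^sub>i\<^sup>(\<^sup>k\<^sup>+\<^sup>1\<^sup>)(y + z)\<close>, so each integration raises the order of an Euler polynomial by one, and
  the \<open>k\<close>-fold integral of \<open>(l * (y\<^sub>1 + \<dots> + y\<^sub>k) + x) ^ m\<close> is \<open>l ^ m * E\<^sub>m\<^sup>(\<^sup>k\<^sup>)(x / l)\<close>. The Stirling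
  numbers expand this power in falling factorials.
\<close>

text \<open>Multiplying \<open>falling_factorial z n\<close> by \<open>z = (z - n) + n\<close>
  reproduces the recursion of the Stirling numbers. Any commutative ring is allowed for
  \<open>z\<close>, so that a polynomial variable can be inserted later.\<close>

lemma power_eq_sum_Stirling_falling_factorial:
  fixes z :: "'c::comm_ring_1"
  shows "z ^ m = (\<Sum>n\<le>m. of_nat (Stirling m n) * falling_factorial z n)"
proof (induction m)
  case 0
  show ?case by (simp add: falling_factorial_def)
next
  case (Suc m)
  let ?F = "falling_factorial z"
  have z: "z * ?F n = ?F (Suc n) + of_nat n * ?F n" for n
    by (simp add: falling_factorial_def algebra_simps)
  have "z ^ Suc m = (\<Sum>n\<le>m. of_nat (Stirling m n) * (z * ?F n))"
    by (simp add: Suc.IH sum_distrib_left mult.left_commute)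
  also have "\<dots> = (\<Sum>n\<le>m. of_nat (Stirling m n) * ?F (Suc n))
      + (\<Sum>n\<le>m. of_nat (n * Stirling m n) * ?F n)"
    by (simp add: z sum.distrib algebra_simps)
  \<comment> \<open>The added term is zero because \<open>Stirling m (Suc m) = 0\<close>, and the
    term at \<open>n = 0\<close> has the factor \<open>0\<close>; hence the sum can be reindexed by
    \<open>Suc n\<close>.\<close>
  also have "(\<Sum>n\<le>m. of_nat (n * Stirling m n) * ?F n)
      = (\<Sum>n\<le>Suc m. of_nat (n * Stirling m n) * ?F n)"
    by (simp add: Stirling_less)
  also have "\<dots> = (\<Sum>n\<le>m. of_nat (Suc n * Stirling m (Suc n)) * ?F (Suc n))"
    by (subst sum.atMost_Suc_shift) simp
  finally show ?case
    by (subst sum.atMost_Suc_shift) (simp add: sum.distrib algebra_simps)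
qed

lemma poly_falling_factorial:
  "poly (falling_factorial [:0, 1:] n) z = falling_factorial (z :: 'c::comm_ring_1) n"
  by (simp add: falling_factorial_def poly_prod)

lemma degree_falling_factorial_le:
  "degree (falling_factorial [:0, 1 :: 'c::comm_ring_1:] n) \<le> n"
proof (induction n)
  case 0
  show ?case by (simp add: falling_factorial_def)
next
  case (Suc n)
  have "degree ([:0, 1 :: 'c:] - of_nat n) \<le> 1"
    by (intro degree_diff_le) auto
  with Suc show ?case
    using degree_mult_le[of "falling_factorial [:0, 1 :: 'c:] n" "[:0, 1:] - of_nat n"]
    by (simp add: falling_factorial_def)
qed

lemma Euler_poly_0: "Euler_poly 0 n x = x ^ n"
  by (simp add: Euler_poly_def)

text \<open>In the generating function, the two exponentials add up to \<open>fps_exp x\<close>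
  times \<open>fps_exp 1 + 1\<close>, which cancels one factor \<open>U\<close> and leaves
  \<open>2\<close>.\<close>

lemma Euler_poly_add_shift:
  fixes x :: "'c::field_char_0"
  shows "Euler_poly (Suc k) n x + Euler_poly (Suc k) n (x + 1) = 2 * Euler_poly k n x"
proof -
  define U :: "'c fps" where "U = 2 / (fps_exp 1 + 1)"
  \<comment> \<open>A nonzero constant term makes the series a unit, so the division in
    \<open>U\<close> is exact.\<close>
  have "fps_nth (fps_exp 1 + 1 :: 'c fps) 0 \<noteq> 0"
    by simp
  then have U: "U * (fps_exp 1 + 1) = fps_const 2"
    unfolding U_def numeral_fps_const[symmetric]
    by (metis dvd_div_mult_self unit_imp_dvd fps_is_unit_iff)
  have "U ^ Suc k * fps_exp x + U ^ Suc k * fps_exp (x + 1)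
      = (U * (fps_exp 1 + 1)) * (U ^ k * fps_exp x)"
    by (simp add: fps_exp_add_mult algebra_simps)
  also have "\<dots> = fps_const 2 * (U ^ k * fps_exp x)"
    by (simp only: U)
  finally have "fps_nth (U ^ Suc k * fps_exp x) n + fps_nth (U ^ Suc k * fps_exp (x + 1)) n
      = 2 * fps_nth (U ^ k * fps_exp x) n"
    by (metis fps_add_nth fps_mult_left_const_nth)
  then show ?thesis
    unfolding Euler_poly_def U_def[symmetric] by (metis distrib_left mult.left_commute)
qed

lemma Euler_poly_eq_poly:
  obtains Q :: "'c::field_char_0 poly" where "\<And>x. Euler_poly k n x = poly Q x"
proof -
  define A :: "'c fps" where "A = (2 / (fps_exp 1 + 1)) ^ k"
  have "Euler_poly k n x =
      poly (\<Sum>i=0..n. monom (fact n * fps_nth A i / fact (n - i)) (n - i)) x" for x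
    unfolding Euler_poly_def A_def[symmetric]
    by (simp add: fps_mult_nth poly_sum poly_monom sum_distrib_left mult.assoc)
  then show ?thesis by (rule that)
qed

lemma padic_complexD:
  assumes "padic_complex p TYPE('c::{field_char_0, complete_space})"
  shows "dist x y = vabs (x - y :: 'c)"
    and "vabs (x * y :: 'c) = vabs x * vabs y"
    and "vabs (x + y :: 'c) \<le> max (vabs x) (vabs y)"
    and "n \<noteq> 0 \<Longrightarrow> vabs (of_int n :: 'c) = 1 / real p ^ multiplicity (int p) n"
  using assms unfolding padic_complex_def by simp_all

text \<open>By Horner's scheme and the ultrametric inequality, each further coefficient
  \<open>a\<close> replaces the bound \<open>C\<close> by \<open>max (vabs a) C\<close>.\<close>

lemma vabs_poly_bounded:
  fixes P :: "'c::{field_char_0, complete_space} poly"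
  assumes "padic_complex p TYPE('c)"
  shows "\<exists>C. \<forall>u. vabs u \<le> 1 \<longrightarrow> vabs (poly P u) \<le> C"
proof (induction P)
  case 0
  show ?case by auto
next
  case (pCons a P)
  then obtain C where C: "\<And>u. vabs u \<le> 1 \<Longrightarrow> vabs (poly P u) \<le> C"
    by blast
  have "vabs (poly (pCons a P) u) \<le> max (vabs a) C" if u: "vabs u \<le> 1" for u
  proof -
    have "vabs (u * poly P u) = vabs u * vabs (poly P u)"
      by (rule padic_complexD(2)[OF assms])
    also have "\<dots> \<le> 1 * C"
      using u C[OF u] by (intro mult_mono) (auto simp: vabs_def)
    finally show ?thesis
      using padic_complexD(3)[OF assms, of a "u * poly P u"] by simp
  qed
  then show ?case by blast
qed

lemma vabs_prime_power:
  assumes "padic_complex p TYPE('c::{field_char_0, complete_space})" "prime p"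
  shows "vabs (of_nat (p ^ N) :: 'c) = (1 / real p) ^ N"
proof -
  have "vabs (of_int (int (p ^ N)) :: 'c) = 1 / real p ^ multiplicity (int p) (int (p ^ N))"
    using prime_gt_0_nat[OF assms(2)] by (intro padic_complexD(4)[OF assms(1)]) simp
  moreover have "multiplicity (int p) (int (p ^ N)) = N"
    using assms(2) by (simp add: multiplicity_same_power prime_gt_0_nat)
  ultimately show ?thesis by (simp add: power_one_over)
qed

text \<open>Writing \<open>G\<close> as \<open>a + u * H u\<close> gives the difference
  \<open>p ^ N * H (p ^ N)\<close>, where the first factor tends to \<open>0\<close> and the second
  is bounded on the unit ball.\<close>

lemma tendsto_poly_prime_power:
  fixes G :: "'c::{field_char_0, complete_space} poly"
  assumes "padic_complex p TYPE('c)" "prime p"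
  shows "(\<lambda>N. poly G (of_nat (p ^ N))) \<longlonglongrightarrow> poly G 0"
proof -
  note dist = padic_complexD(1)[OF assms(1)] and mult = padic_complexD(2)[OF assms(1)]
  obtain a H where G: "G = pCons a H"
    by (cases G)
  obtain C where C: "\<And>u. vabs u \<le> 1 \<Longrightarrow> vabs (poly H u) \<le> C"
    using vabs_poly_bounded[OF assms(1)] by blast
  have p: "1 < real p"
    using assms(2) prime_gt_1_nat by simp
  have "(\<lambda>N. (1 / real p) ^ N * C) \<longlonglongrightarrow> 0 * C"
    using p by (intro tendsto_mult LIMSEQ_realpow_zero tendsto_const) auto
  then have lim: "(\<lambda>N. (1 / real p) ^ N * C) \<longlonglongrightarrow> 0"
    by simp
  have bound: "dist (poly G (of_nat (p ^ N))) (poly G 0) \<le> (1 / real p) ^ N * C" for N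
  proof -
    have "(1 / real p) ^ N \<le> 1"
      using p by (intro power_le_one) auto
    then have "vabs (poly H (of_nat (p ^ N))) \<le> C"
      using vabs_prime_power[OF assms] by (intro C) metis
    moreover have "dist (poly G (of_nat (p ^ N))) (poly G 0)
        = (1 / real p) ^ N * vabs (poly H (of_nat (p ^ N)))"
      unfolding dist vabs_prime_power[OF assms, symmetric] mult[symmetric] by (simp add: G)
    ultimately show ?thesis
      by (simp add: mult_left_mono)
  qed
  have "(\<lambda>N. dist (poly G (of_nat (p ^ N))) (poly G 0)) \<longlonglongrightarrow> 0"
    by (rule tendsto_sandwich[OF _ _ tendsto_const lim])
       (simp_all only: zero_le_dist bound eventually_True)
  then show ?thesis
    by (rule tendsto_dist_iff[THEN iffD2])
qed

lemma fermionic_integral_eqI: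
  fixes f :: "'c::{field_char_0, complete_space} \<Rightarrow> 'c"
  assumes "padic_complex p TYPE('c)" "prime p" "odd p"
    and fG: "\<And>y. poly G y + poly G (y + 1) = 2 * f y"
  shows "fermionic_integral p f = poly G 0"
proof -
  have telescope: "2 * (\<Sum>a<M. f (of_nat a) * (- 1) ^ a)
      = poly G 0 - (- 1) ^ M * poly G (of_nat M)" for M
  proof (induction M)
    case (Suc M)
    have "2 * (\<Sum>a<Suc M. f (of_nat a) * (- 1) ^ a)
        = poly G 0 - (- 1) ^ M * poly G (of_nat M) + (2 * f (of_nat M)) * (- 1) ^ M"
      by (simp only: sum.lessThan_Suc distrib_left Suc.IH mult.assoc)
    then show ?case
      by (simp add: fG[symmetric] algebra_simps)
  qed simp
  \<comment> \<open>For odd \<open>M = p ^ N\<close> the sign in \<open>telescope\<close> turns the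
    partial sum into the value of this polynomial at \<open>p ^ N\<close>; at \<open>0\<close> its
    value is \<open>poly G 0\<close>.\<close>
  let ?H = "smult (1 / 2) ([:poly G 0:] + G)"
  have "(\<Sum>a<p ^ N. f (of_nat a) * (- 1) ^ a) = poly ?H (of_nat (p ^ N))" for N
    using telescope[of "p ^ N"] assms(3) by (simp add: field_simps)
  then have "(\<lambda>N. \<Sum>a<p ^ N. f (of_nat a) * (- 1) ^ a) \<longlonglongrightarrow> poly ?H 0"
    using tendsto_poly_prime_power[OF assms(1,2)] by presburger
  then show ?thesis
    unfolding fermionic_integral_def by (simp add: limI)
qed

text \<open>All monomials of \<open>P\<close> are integrated together, which avoids proving
  convergence for each before adding limits. The bound \<open>m\<close> gives falling factorials of
  different degrees a common range of summation.\<close>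

lemma iterated_fermionic_integral_poly:
  fixes l x :: "'c::{field_char_0, complete_space}"
  assumes "padic_complex p TYPE('c)" "prime p" "odd p" "l \<noteq> 0" "degree P \<le> m"
  shows "iterated_fermionic_integral p k (\<lambda>ys. poly P ((\<Sum>y\<leftarrow>ys. l * y) + x)) =
    (\<Sum>i\<le>m. coeff P i * l ^ i * Euler_poly k i (x / l))"
proof (induction k arbitrary: x)
  case 0
  show ?case
  proof -
    have "poly P x = poly (\<Sum>i\<le>m. monom (coeff P i) i) x"
      by (simp only: poly_as_sum_of_monoms'[OF assms(5)])
    with assms(4) show ?thesis
      by (simp add: Euler_poly_0 power_divide poly_sum poly_monom)
  qed
next
  case (Suc k)
  have "\<forall>i. \<exists>Q :: 'c poly. \<forall>x. Euler_poly (Suc k) i x = poly Q x"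
    by (metis Euler_poly_eq_poly)
  then obtain Q :: "nat \<Rightarrow> 'c poly" where Q: "\<And>i x. Euler_poly (Suc k) i x = poly (Q i) x"
    by metis
  define G where "G = (\<Sum>i\<le>m. smult (coeff P i * l ^ i) (pcompose (Q i) [:x / l, 1:]))"
  have G: "poly G y = (\<Sum>i\<le>m. coeff P i * l ^ i * Euler_poly (Suc k) i (x / l + y))" for y
    by (simp add: G_def poly_sum poly_pcompose Q)
  have "iterated_fermionic_integral p (Suc k) (\<lambda>ys. poly P ((\<Sum>y\<leftarrow>ys. l * y) + x))
      = fermionic_integral p (\<lambda>y. \<Sum>i\<le>m. coeff P i * l ^ i * Euler_poly k i (x / l + y))"
    \<comment> \<open>The outermost variable is absorbed into the shift:
      \<open>(l * y + x) / l = x / l + y\<close>.\<close>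
    using Suc.IH[of "l * y + x" for y] assms(4)
    by (simp add: add.assoc add_divide_distrib add.commute[of _ "x / l"])
  also have "\<dots> = poly G 0"
  proof (rule fermionic_integral_eqI[OF assms(1-3)])
    show "poly G y + poly G (y + 1)
        = 2 * (\<Sum>i\<le>m. coeff P i * l ^ i * Euler_poly k i (x / l + y))" for y
      unfolding G sum.distrib[symmetric] sum_distrib_left
    proof (rule sum.cong)
      fix i
      have "coeff P i * l ^ i * Euler_poly (Suc k) i (x / l + y)
          + coeff P i * l ^ i * Euler_poly (Suc k) i (x / l + (y + 1))
        = coeff P i * l ^ i * (2 * Euler_poly k i (x / l + y))"
        by (simp only: Euler_poly_add_shift[symmetric] distrib_left add.assoc)
      then show "coeff P i * l ^ i * Euler_poly (Suc k) i (x / l + y)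
          + coeff P i * l ^ i * Euler_poly (Suc k) i (x / l + (y + 1))
        = 2 * (coeff P i * l ^ i * Euler_poly k i (x / l + y))"
        by (simp only: mult.left_commute)
    qed simp
  qed
  finally show ?case by (simp add: G)
qed

theorem theorem3:
  fixes p k m :: nat and l x :: "'c::{field_char_0, complete_space}"
  assumes "padic_complex p TYPE('c)"
    and "prime p" and "odd p"
    and "l \<in> padic_integers" and "l \<noteq> 0"
  shows "(\<Sum>n=0..m. Boole_poly p k n x l * of_nat (Stirling m n)) =
         l ^ m / 2 ^ k * Euler_poly k m (x / l)"
proof -
  let ?F = "\<lambda>n. falling_factorial [:0, 1 :: 'c:] n"
  let ?e = "\<lambda>i. l ^ i * Euler_poly k i (x / l)"
  have Boole: "Boole_poly p k n x l = (\<Sum>i\<le>m. coeff (?F n) i * ?e i) / 2 ^ k" if "n \<le> m" for n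
    using iterated_fermionic_integral_poly[OF assms(1-3,5), of "?F n" m k x]
      degree_falling_factorial_le[of n, where 'c = 'c] that
    by (simp add: Boole_poly_def poly_falling_factorial mult.assoc)
  \<comment> \<open>As an identity of polynomials, the expansion allows coefficients to be compared:
    the Stirling-weighted coefficients sum to \<open>1\<close> at \<open>i = m\<close> and to
    \<open>0\<close> elsewhere, so only the Euler polynomial of index \<open>m\<close>
    survives.\<close>
  have "monom 1 m = (\<Sum>n\<le>m. of_nat (Stirling m n) * ?F n)"
    by (simp only: monom_altdef smult_1_left power_eq_sum_Stirling_falling_factorial)
  then have "coeff (monom 1 m) i = (\<Sum>n\<le>m. of_nat (Stirling m n) * coeff (?F n) i)" for i
    by (simp add: coeff_sum of_nat_poly)
  then have Stirling: "(\<Sum>n\<le>m. of_nat (Stirling m n) * coeff (?F n) i) = (if m = i then 1 else 0)" for i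
    by (metis coeff_monom)
  have "(\<Sum>n=0..m. Boole_poly p k n x l * of_nat (Stirling m n))
      = (\<Sum>n\<le>m. \<Sum>i\<le>m. of_nat (Stirling m n) * coeff (?F n) i * ?e i) / 2 ^ k"
    by (simp add: Boole atMost_atLeast0 sum_divide_distrib sum_distrib_left sum_distrib_right
        mult_ac)
  also have "\<dots> = (\<Sum>i\<le>m. (\<Sum>n\<le>m. of_nat (Stirling m n) * coeff (?F n) i) * ?e i) / 2 ^ k"
    by (subst sum.swap) (simp only: sum_distrib_right)
  also have "\<dots> = ?e m / 2 ^ k"
    by (simp add: Stirling if_distrib[of "\<lambda>c. c * _"] cong: if_cong)
  finally show ?thesis by simp
qed

end
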